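(* Let $H$ be a cubic bipartite plane graph and let $l_1,l_2,l_3$ be pairwise non-parallel lines in the plane. Suppose that $H$ is drawn in such a way that every vertex has incident edges parallel to $l_1$, $l_2$ and $l_3$ (exactly one incident edge in each of the three directions). Then the number of claws in the drawing is equal to the number of tripods.
   Context: Graphs are finite. A plane graph is a graph drawn in $\mathbb{R}^2$ without crossings (edges meet only at common endpoints); here every edge is drawn as a straight line segment. A graph is cubic if every vertex has degree $3$. For a drawn cubic graph, a vertex $v$ is called a claw if the three edges incident to $v$ (with $v$ itself removed) lie in a common open half-plane whose boundary line passes through $v$; otherwise $v$ is called a tripod. *)

theory Defs
  imports "HOL-Analysis.Analysis"
begin

text \<open>
  Graphs are finite, simple and undirected, with vertex set \<open>V\<close> and edges given as two-element
  subsets of \<open>V\<close>. Excluding loops and multiple edges is no restriction for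
  crossing-free drawings with straight edges: a loop would degenerate to a point, and parallel
  edges would be drawn as the same segment.
\<close>

definition finite_graph :: "'a set \<Rightarrow> 'a set set \<Rightarrow> bool" where
  "finite_graph V E \<longleftrightarrow> finite V \<and> (\<forall>e\<in>E. e \<subseteq> V \<and> card e = 2)"

definition incident_edges :: "'a set set \<Rightarrow> 'a \<Rightarrow> 'a set set" where
  "incident_edges E v = {e \<in> E. v \<in> e}"

definition cubic :: "'a set \<Rightarrow> 'a set set \<Rightarrow> bool" where
  "cubic V E \<longleftrightarrow> (\<forall>v\<in>V. card (incident_edges E v) = 3)"

definition bipartite :: "'a set \<Rightarrow> 'a set set \<Rightarrow> bool" where
  "bipartite V E \<longleftrightarrow>
     (\<exists>A B. A \<union> B = V \<and> A \<inter> B = {} \<and> (\<forall>e\<in>E. \<exists>a\<in>A. \<exists>b\<in>B. e = {a, b}))"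

text \<open>
  For an edge \<open>e = {u, v}\<close>, the convex hull of \<open>pos ` e\<close> is the closed segment from \<open>pos u\<close>
  to \<open>pos v\<close> (see \<open>segment_convex_hull\<close>).
\<close>

definition edge_segment :: "('a \<Rightarrow> real^2) \<Rightarrow> 'a set \<Rightarrow> (real^2) set" where
  "edge_segment pos e = convex hull (pos ` e)"

definition straight_plane_drawing ::
  "'a set \<Rightarrow> 'a set set \<Rightarrow> ('a \<Rightarrow> real^2) \<Rightarrow> bool" where
  "straight_plane_drawing V E pos \<longleftrightarrow>
     inj_on pos V \<and>
     (\<forall>v\<in>V. \<forall>e\<in>E. pos v \<in> edge_segment pos e \<longrightarrow> v \<in> e) \<and>
     (\<forall>e\<in>E. \<forall>f\<in>E. e \<noteq> f \<longrightarrow> edge_segment pos e \<inter> edge_segment pos f \<subseteq> pos ` (e \<inter> f))"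

definition is_line :: "(real^2) set \<Rightarrow> bool" where
  "is_line l \<longleftrightarrow> affine l \<and> aff_dim l = 1"

text \<open>
  Since \<open>affine_parallel\<close> means being a translate, an edge lying on \<open>l\<close> itself
  also counts as parallel to \<open>l\<close>.
\<close>

definition edge_parallel :: "('a \<Rightarrow> real^2) \<Rightarrow> 'a set \<Rightarrow> (real^2) set \<Rightarrow> bool" where
  "edge_parallel pos e l \<longleftrightarrow> affine_parallel (affine hull (pos ` e)) l"

text \<open>
  The open half-planes with \<open>pos v\<close> on the boundary line are the sets
  \<open>{x. n \<bullet> x > n \<bullet> pos v}\<close> with \<open>n \<noteq> 0\<close>.
\<close>

definition is_claw :: "'a set set \<Rightarrow> ('a \<Rightarrow> real^2) \<Rightarrow> 'a \<Rightarrow> bool" where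
  "is_claw E pos v \<longleftrightarrow>
     (\<exists>n. n \<noteq> 0 \<and>
       (\<forall>e\<in>incident_edges E v. edge_segment pos e - {pos v} \<subseteq> {x. n \<bullet> x > n \<bullet> pos v}))"

definition is_tripod :: "'a set set \<Rightarrow> ('a \<Rightarrow> real^2) \<Rightarrow> 'a \<Rightarrow> bool" where
  "is_tripod E pos v \<longleftrightarrow> \<not> is_claw E pos v"

end

theory Submission
  imports Defs
begin

text \<open>
  A linear change of coordinates makes the three directions horizontal, vertical and diagonal
  (slope one). The edges of each direction form a perfect matching, so the horizontal and vertical
  edges together split the graph into vertex-disjoint rectilinear polygons, whose vertices
  alternate between the two colour classes. The theorem holds on every single polygon: half of its
  vertices are tripods.

  Fix a polygon \<open>C\<close> and call a vertex of the graph inner or outer according to whether its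
  diagonal edge runs inside or outside \<open>C\<close>. The inner vertices are closed under the diagonal
  matching, so they contain equally many vertices of both classes. The inner vertices not on
  \<open>C\<close> are closed under the horizontal matching, because these edges do not cross \<open>C\<close>; so they
  are balanced as well. By subtraction, the inner vertices on \<open>C\<close> are balanced, and likewise the
  outer ones (lemma \<open>sum_sgn_class_side\<close>).

  Being a tripod depends only on the cyclic order of the three directions at the vertex: it is one
  order at all tripods and the opposite order at all claws. Hence when one walks along \<open>C\<close>, whose
  edges are alternately horizontal and vertical, the diagonal edge stays on the same side
  of \<open>C\<close> from one vertex to the next exactly if one of the two vertices is a tripod and the other is
  a claw (lemmas \<open>side_step_h\<close> and \<open>side_step_b\<close>). The colour class also changes at each step, so
  on the inner vertices of \<open>C\<close> the tripods are exactly the vertices of one class, and on the outer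
  vertices exactly those of the other class. With the balance of the classes, the tripods are half
  of the vertices of \<open>C\<close>.

  No form of the Jordan curve theorem is needed. The parity of the number of vertices of \<open>C\<close>
  that lie strictly to the northwest of a point is locally constant off \<open>C\<close>, and it tells the two
  sides of \<open>C\<close> apart: the upward vertical ray from a point crosses the horizontal edges of \<open>C\<close>
  that have exactly one of their endpoints to the northwest, so this is the usual
  ray-crossing parity.
\<close>

section \<open>Parity\<close>

lemma even_card_involution:
  assumes "finite S" "\<And>x. x \<in> S \<Longrightarrow> f x \<in> S \<and> f (f x) = x \<and> f x \<noteq> x"
  shows "even (card S)"
  using assms
proof (induction S rule: finite_psubset_induct)
  case (psubset S)
  show ?case
  proof (cases "S = {}")
    case False
    then obtain x where x: "x \<in> S" by blast
    let ?T = "S - {x, f x}"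
    have fx: "f x \<in> S" "f (f x) = x" "f x \<noteq> x" using psubset.prems x by auto
    have "even (card ?T)"
    proof (rule psubset.IH)
      show "?T \<subset> S" using x by auto
      show "f y \<in> ?T \<and> f (f y) = y \<and> f y \<noteq> y" if "y \<in> ?T" for y
        using psubset.prems[of y] that fx by (metis DiffD1 DiffD2 DiffI insert_iff singletonD)
    qed
    moreover have "card S = card ?T + 2"
    proof -
      have "card (?T \<union> {x, f x}) = card ?T + card {x, f x}"
        using psubset.hyps by (intro card_Un_disjoint) auto
      moreover have "?T \<union> {x, f x} = S" using x fx by blast
      ultimately show ?thesis using fx by auto
    qed
    ultimately show ?thesis by simp
  qed simp
qed

lemma odd_card_Collect:
  assumes "finite W"
  shows "odd (card {w \<in> W. P w \<noteq> Q w}) \<longleftrightarrow> odd (card {w \<in> W. P w}) \<noteq> odd (card {w \<in> W. Q w})"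
proof -
  let ?a = "card {w \<in> W. P w \<and> Q w}"
  let ?b = "card {w \<in> W. P w \<and> \<not> Q w}"
  let ?c = "card {w \<in> W. \<not> P w \<and> Q w}"
  have "card {w \<in> W. P w} = ?a + ?b"
    using assms by (subst card_Un_disjoint[symmetric]) (auto intro!: arg_cong[where f=card])
  moreover have "card {w \<in> W. Q w} = ?a + ?c"
    using assms by (subst card_Un_disjoint[symmetric]) (auto intro!: arg_cong[where f=card])
  moreover have "card {w \<in> W. P w \<noteq> Q w} = ?b + ?c"
    using assms by (subst card_Un_disjoint[symmetric]) (auto intro!: arg_cong[where f=card])
  ultimately show ?thesis by auto
qed

lemma sum_involution_eq_0:
  fixes g :: "'a \<Rightarrow> int"
  assumes "\<And>x. x \<in> S \<Longrightarrow> f x \<in> S \<and> f (f x) = x \<and> g (f x) = - g x"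
  shows "sum g S = 0"
proof -
  have "bij_betw f S S"
    by (rule bij_betw_byWitness[where f'=f]) (use assms in auto)
  then have "sum g S = (\<Sum>x\<in>S. g (f x))"
    by (simp add: sum.reindex_bij_betw)
  also have "\<dots> = - sum g S"
    using assms by (simp add: sum_negf)
  finally show ?thesis by simp
qed

lemma tendsto_eventually_same_side:
  fixes c x :: real
  assumes "(g \<longlongrightarrow> x) F" "c \<noteq> x"
  shows "eventually (\<lambda>y. c < g y \<longleftrightarrow> c < x) F" "eventually (\<lambda>y. g y < c \<longleftrightarrow> x < c) F"
proof -
  have "eventually (\<lambda>y. (c < g y \<longleftrightarrow> c < x) \<and> (g y < c \<longleftrightarrow> x < c)) F"
  proof (cases "c < x")
    case True
    then show ?thesis using order_tendstoD(1)[OF assms(1) True] by (auto elim: eventually_mono)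
  next
    case False
    then have "x < c" using assms by simp
    then show ?thesis using order_tendstoD(2)[OF assms(1), of c] by (auto elim: eventually_mono)
  qed
  then show "eventually (\<lambda>y. c < g y \<longleftrightarrow> c < x) F" "eventually (\<lambda>y. g y < c \<longleftrightarrow> x < c) F"
    by (auto elim: eventually_mono)
qed

section \<open>Drawings in three directions\<close>

text \<open>
  \<open>h\<close>, \<open>b\<close> and \<open>d\<close> send a vertex to its neighbour along the horizontal, vertical and diagonal edge,
  and \<open>A\<close> is one of the two colour classes.
\<close>

locale three_direction_drawing =
  fixes V :: "'a set" and p :: "'a \<Rightarrow> real \<times> real" and h b d :: "'a \<Rightarrow> 'a" and A :: "'a set"
  assumes finite_V: "finite V"
    and inj_p: "inj_on p V"
    and matching: "\<And>f v. f \<in> {h, b, d} \<Longrightarrow> v \<in> V \<Longrightarrow>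
          f v \<in> V \<and> f (f v) = v \<and> f v \<noteq> v \<and> (f v \<in> A \<longleftrightarrow> v \<notin> A)"
    and horizontal: "\<And>v. v \<in> V \<Longrightarrow> snd (p (h v)) = snd (p v)"
    and vertical: "\<And>v. v \<in> V \<Longrightarrow> fst (p (b v)) = fst (p v)"
    and diagonal: "\<And>v. v \<in> V \<Longrightarrow> snd (p (d v)) - snd (p v) = fst (p (d v)) - fst (p v)"
    and noncrossing: "\<And>u v f g z. u \<in> V \<Longrightarrow> v \<in> V \<Longrightarrow> f \<in> {h, b, d} \<Longrightarrow> g \<in> {h, b, d} \<Longrightarrow>
          {u, f u} \<noteq> {v, g v} \<Longrightarrow> z \<in> closed_segment (p u) (p (f u)) \<Longrightarrow>
          z \<in> closed_segment (p v) (p (g v)) \<Longrightarrow> z \<in> p ` ({u, f u} \<inter> {v, g v})"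
begin

text \<open>
  Reflection in the line \<open>y = - x\<close> swaps horizontal and vertical edges, and it preserves the
  northwest quadrant of a point. It transfers every result on horizontal edges to vertical ones.
\<close>

lemma mirror: "three_direction_drawing V (\<lambda>v. (- snd (p v), - fst (p v))) b h d A"
proof
  let ?m = "\<lambda>z :: real \<times> real. (- snd z, - fst z)"
  have lin: "linear ?m"
    by (rule linearI) auto
  have inj: "inj ?m"
    by (auto simp: inj_on_def prod_eq_iff)
  show "inj_on (\<lambda>v. ?m (p v)) V"
    using inj_p by (auto simp: inj_on_def prod_eq_iff)
  show "z \<in> (\<lambda>v. ?m (p v)) ` ({u, f u} \<inter> {v, g v})"
    if "u \<in> V" "v \<in> V" "f \<in> {b, h, d}" "g \<in> {b, h, d}" "{u, f u} \<noteq> {v, g v}"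
      "z \<in> closed_segment (?m (p u)) (?m (p (f u)))"
      "z \<in> closed_segment (?m (p v)) (?m (p (g v)))" for u v f g z
  proof -
    have "z \<in> ?m ` closed_segment (p u) (p (f u))" "z \<in> ?m ` closed_segment (p v) (p (g v))"
      using that closed_segment_linear_image[OF lin] by auto
    then obtain y where y: "z = ?m y" "y \<in> closed_segment (p u) (p (f u))" "y \<in> closed_segment (p v) (p (g v))"
      using inj by (auto simp: inj_on_def prod_eq_iff)
    have "y \<in> p ` ({u, f u} \<inter> {v, g v})"
      using noncrossing[of u v f g y] that y by auto
    then show ?thesis using y by auto
  qed
qed (use finite_V matching horizontal vertical diagonal in \<open>auto simp: algebra_simps\<close>)

abbreviation X :: "'a \<Rightarrow> real" where "X v \<equiv> fst (p v)"
abbreviation Y :: "'a \<Rightarrow> real" where "Y v \<equiv> snd (p v)"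

text \<open>
  Positive multiples of \<open>(1, 0)\<close>, \<open>(0, 1)\<close> and \<open>(- 1, - 1)\<close> sum to zero, so no open half-plane
  with boundary through the origin contains all three; the same holds for the three opposite
  vectors. All other choices of signs give a claw (lemma \<open>half_plane_iff_signs\<close> below).
\<close>

definition tripod :: "'a \<Rightarrow> bool" where
  "tripod v \<longleftrightarrow> (X v < X (h v) \<longleftrightarrow> Y v < Y (b v)) \<and> (X v < X (h v) \<longleftrightarrow> X (d v) < X v)"

text \<open>
  The minimal nonempty sets of this kind are the vertex sets of the rectilinear polygons.
\<close>

definition two_direction_closed :: "'a set \<Rightarrow> bool" where
  "two_direction_closed W \<longleftrightarrow> W \<subseteq> V \<and> h ` W \<subseteq> W \<and> b ` W \<subseteq> W"

definition odd_northwest :: "'a set \<Rightarrow> real \<times> real \<Rightarrow> bool" where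
  "odd_northwest W q \<longleftrightarrow> odd (card {w \<in> W. X w < fst q \<and> snd q < Y w})"

definition off_edges :: "'a set \<Rightarrow> real \<times> real \<Rightarrow> bool" where
  "off_edges W q \<longleftrightarrow>
     (\<forall>w\<in>W. q \<notin> closed_segment (p w) (p (h w)) \<and> q \<notin> closed_segment (p w) (p (b w)))"

text \<open>
  The midpoint represents the diagonal edge as a whole: the parity is constant on its interior.
\<close>

definition side :: "'a set \<Rightarrow> 'a \<Rightarrow> bool" where
  "side W v \<longleftrightarrow> odd_northwest W (midpoint (p v) (p (d v)))"

lemma pos_eq_iff: "u \<in> V \<Longrightarrow> v \<in> V \<Longrightarrow> X u = X v \<and> Y u = Y v \<longleftrightarrow> u = v"
  using inj_p by (auto simp: inj_on_def prod_eq_iff)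

lemma X_h: "v \<in> V \<Longrightarrow> X (h v) \<noteq> X v"
  using pos_eq_iff[of "h v" v] matching[of h v] horizontal[of v] by auto

lemma Y_b: "v \<in> V \<Longrightarrow> Y (b v) \<noteq> Y v"
  using pos_eq_iff[of "b v" v] matching[of b v] vertical[of v] by auto

lemma X_d: "v \<in> V \<Longrightarrow> X (d v) \<noteq> X v"
  using pos_eq_iff[of "d v" v] matching[of d v] diagonal[of v] by auto

lemma mem_horizontal_edge:
  assumes "w \<in> V"
  shows "q \<in> closed_segment (p w) (p (h w)) \<longleftrightarrow>
    snd q = Y w \<and> (X w \<le> fst q \<and> fst q \<le> X (h w) \<or> X (h w) \<le> fst q \<and> fst q \<le> X w)"
  using horizontal[OF assms]
  by (subst closed_segment_same_snd) (auto simp: closed_segment_eq_real_ivl mem_Times_iff)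

lemma mem_vertical_edge:
  assumes "w \<in> V"
  shows "q \<in> closed_segment (p w) (p (b w)) \<longleftrightarrow>
    fst q = X w \<and> (Y w \<le> snd q \<and> snd q \<le> Y (b w) \<or> Y (b w) \<le> snd q \<and> snd q \<le> Y w)"
  using vertical[OF assms]
  by (subst closed_segment_same_fst) (auto simp: closed_segment_eq_real_ivl mem_Times_iff)

lemma distinct_edges:
  assumes "v \<in> V"
  shows "h v \<noteq> b v" "h v \<noteq> d v" "b v \<noteq> d v"
  using X_h[OF assms] Y_b[OF assms] X_d[OF assms] horizontal[OF assms] vertical[OF assms]
    diagonal[OF assms] by auto

text \<open>
  The diagonal edges touch the polygons at most in their own endpoints, so the parity is constant
  along each of them, with an endpoint included if it is not on a polygon in \<open>W\<close>.
\<close>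

lemma off_edges_d:
  assumes W: "two_direction_closed W" and u: "u \<in> V"
    and z: "z \<in> closed_segment (p u) (p (d u))" "z \<noteq> p (d u)" "z \<noteq> p u \<or> u \<notin> W"
  shows "off_edges W z"
  unfolding off_edges_def
proof (intro ballI)
  fix w assume w: "w \<in> W"
  have wV: "w \<in> V" and cl: "h w \<in> W" "b w \<in> W" using W w by (auto simp: two_direction_closed_def)
  have "z \<notin> closed_segment (p w) (p (f w))" if f: "f \<in> {h, b}" for f
  proof
    assume "z \<in> closed_segment (p w) (p (f w))"
    moreover have "{u, d u} \<noteq> {w, f w}"
      using f distinct_edges[OF wV] distinct_edges[OF u] matching[of f w] wV matching[of d u] u
      by (auto simp: doubleton_eq_iff)
    ultimately have "z \<in> p ` ({u, d u} \<inter> {w, f w})"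
      using noncrossing[of u w d f z] u wV z f by auto
    then show False using z w cl f by auto
  qed
  then show "z \<notin> closed_segment (p w) (p (h w)) \<and> z \<notin> closed_segment (p w) (p (b w))"
    by auto
qed

lemma off_edges_outside:
  assumes W: "two_direction_closed W" and u: "u \<in> V" "u \<notin> W" and f: "f \<in> {h, b}"
    and z: "z \<in> closed_segment (p u) (p (f u))"
  shows "off_edges W z"
  unfolding off_edges_def
proof (intro ballI)
  fix w assume w: "w \<in> W"
  have wV: "w \<in> V" and cl: "h w \<in> W" "b w \<in> W" using W w by (auto simp: two_direction_closed_def)
  have fu: "f u \<notin> W"
  proof
    assume "f u \<in> W"
    then have "f (f u) \<in> W" using f W by (auto simp: two_direction_closed_def)
    then show False using matching[of f u] f u by auto
  qed
  have "z \<notin> closed_segment (p w) (p (g w))" if g: "g \<in> {h, b}" for g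
  proof
    assume "z \<in> closed_segment (p w) (p (g w))"
    moreover have disj: "{u, f u} \<inter> {w, g w} = {}"
      using w cl u fu g by auto
    moreover have "{u, f u} \<noteq> {w, g w}" using disj by blast
    ultimately have "z \<in> p ` ({u, f u} \<inter> {w, g w})"
      using noncrossing[of u w f g z] u wV z f g by auto
    then show False using disj by auto
  qed
  then show "z \<notin> closed_segment (p w) (p (h w)) \<and> z \<notin> closed_segment (p w) (p (b w))"
    by auto
qed

section \<open>The northwest parity\<close>

text \<open>
  When a point \<open>q\<close> moves slightly, only vertices on the vertical or the horizontal line through \<open>q\<close>
  can enter or leave its northwest quadrant. Since \<open>q\<close> is on no edge, the two ends of a vertical
  edge on the vertical line are on the same side of \<open>q\<close>, so they enter or leave together; the same
  holds for horizontal edges on the horizontal line.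
\<close>

lemma odd_northwest_locally_constant:
  assumes W: "two_direction_closed W" and q: "off_edges W q"
  shows "eventually (\<lambda>z. odd_northwest W q = odd_northwest W z) (at q within S)"
proof -
  have finW: "finite W" using W finite_V finite_subset by (auto simp: two_direction_closed_def)
  have tx: "(fst \<longlongrightarrow> fst q) (at q within S)" and ty: "(snd \<longlongrightarrow> snd q) (at q within S)"
    by (auto intro!: tendsto_intros)
  have "eventually (\<lambda>z. \<forall>w\<in>W. X w \<noteq> fst q \<longrightarrow> (X w < fst z \<longleftrightarrow> X w < fst q)) (at q within S)"
    by (intro eventually_ball_finite finW ballI)
      (use tendsto_eventually_same_side(1)[OF tx] in simp)
  moreover have "eventually (\<lambda>z. \<forall>w\<in>W. Y w \<noteq> snd q \<longrightarrow> (snd z < Y w \<longleftrightarrow> snd q < Y w)) (at q within S)"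
    by (intro eventually_ball_finite finW ballI)
      (use tendsto_eventually_same_side(2)[OF ty] in simp)
  ultimately show ?thesis
  proof eventually_elim
    case (elim z)
    let ?D = "{w \<in> W. (X w < fst q \<and> snd q < Y w) \<noteq> (X w < fst z \<and> snd z < Y w)}"
    let ?f = "\<lambda>w. if X w = fst q then b w else h w"
    have "even (card ?D)"
    proof (rule even_card_involution[where f = ?f])
      show "finite ?D" using finW by simp
      fix w assume w: "w \<in> ?D"
      have wV: "w \<in> V" and cl: "h w \<in> W" "b w \<in> W" using W w by (auto simp: two_direction_closed_def)
      note m = matching[of h w] matching[of b w]
      have nh: "q \<notin> closed_segment (p w) (p (h w))" and nb: "q \<notin> closed_segment (p w) (p (b w))"
        using q w by (auto simp: off_edges_def)
      show "?f w \<in> ?D \<and> ?f (?f w) = w \<and> ?f w \<noteq> w"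
      proof (cases "X w = fst q")
        case True
        then have "Y w \<noteq> snd q" "Y (b w) \<noteq> snd q" "snd q < Y w \<longleftrightarrow> snd q < Y (b w)"
          using nb mem_vertical_edge[OF wV, of q] by auto
        then show ?thesis using True w m wV cl elim vertical[OF wV] by auto
      next
        case False
        then have y: "Y w = snd q" using w elim by auto
        then have "X (h w) \<noteq> fst q" "X w < fst q \<longleftrightarrow> X (h w) < fst q"
          using nh False mem_horizontal_edge[OF wV, of q] by auto
        then show ?thesis using False y w m wV cl elim horizontal[OF wV] by auto
      qed
    qed
    then show ?case
      using odd_card_Collect[OF finW, of "\<lambda>w. X w < fst q \<and> snd q < Y w" "\<lambda>w. X w < fst z \<and> snd z < Y w"]
      by (simp add: odd_northwest_def)
  qed
qed

lemma odd_northwest_constant: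
  assumes "two_direction_closed W" "\<And>z. z \<in> closed_segment q q' \<Longrightarrow> off_edges W z"
  shows "odd_northwest W q = odd_northwest W q'"
  by (rule connected_local_const[of "closed_segment q q'"])
    (use odd_northwest_locally_constant assms in auto)

lemma midpoint_off_end:
  assumes "u \<in> V" "z \<in> closed_segment (p u) (midpoint (p u) (p (d u)))"
  shows "z \<in> closed_segment (p u) (p (d u))" "z \<noteq> p (d u)"
proof -
  have "closed_segment (p u) (midpoint (p u) (p (d u))) \<subseteq> closed_segment (p u) (p (d u))"
    by (simp add: subset_closed_segment)
  then show "z \<in> closed_segment (p u) (p (d u))" using assms by blast
  show "z \<noteq> p (d u)"
  proof
    assume "z = p (d u)"
    then have "dist (p u) (p (d u)) \<le> dist (p u) (midpoint (p u) (p (d u)))"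
      using assms(2) dist_in_closed_segment[of z "p u" "midpoint (p u) (p (d u))"]
      by (simp add: dist_commute)
    then have "p u = p (d u)" by (simp add: dist_midpoint)
    then show False using X_d[OF assms(1)] by simp
  qed
qed

lemma side_d: "u \<in> V \<Longrightarrow> side W (d u) = side W u"
  using matching[of d u] by (simp add: side_def midpoint_sym)

lemma side_outside:
  assumes "two_direction_closed W" "u \<in> V" "u \<notin> W"
  shows "side W u = odd_northwest W (p u)"
  unfolding side_def
  using odd_northwest_constant[of W "p u" "midpoint (p u) (p (d u))"]
    off_edges_d[of W u] midpoint_off_end[of u] assms by blast

lemma side_step_outside:
  assumes W: "two_direction_closed W" and u: "u \<in> V" "u \<notin> W" and f: "f \<in> {h, b}"
  shows "side W (f u) = side W u"
proof -
  have "f u \<notin> W"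
  proof
    assume "f u \<in> W"
    then have "f (f u) \<in> W" using f W by (auto simp: two_direction_closed_def)
    then show False using matching[of f u] f u by auto
  qed
  moreover have "f u \<in> V" using matching[of f u] f u by auto
  moreover have "odd_northwest W (p u) = odd_northwest W (p (f u))"
    using odd_northwest_constant[of W "p u" "p (f u)"] off_edges_outside[OF W u f] W by blast
  ultimately show ?thesis using side_outside[OF W] u by simp
qed

text \<open>
  The parity is evaluated at a point of the diagonal edge so close to \<open>u\<close> that no coordinate of
  a vertex lies strictly between; the vertices that share a coordinate with \<open>u\<close> then count or
  not according to the direction in which the diagonal edge leaves \<open>u\<close>.
\<close>

lemma side_near:
  assumes W: "two_direction_closed W" and u: "u \<in> W"
  shows "side W u \<longleftrightarrow>
    (if X u < X (d u) then odd (card {w \<in> W. X w \<le> X u \<and> Y u < Y w})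
     else odd (card {w \<in> W. X w < X u \<and> Y u \<le> Y w}))"
proof -
  have finW: "finite W" using W finite_V finite_subset by (auto simp: two_direction_closed_def)
  have uV: "u \<in> V" using W u by (auto simp: two_direction_closed_def)
  define m where "m = X (d u) - X u"
  have m: "m \<noteq> 0" "Y (d u) - Y u = m" using X_d[OF uV] diagonal[OF uV] by (auto simp: m_def)
  define z where "z t = p u + t *\<^sub>R (p (d u) - p u)" for t :: real
  have fz: "fst (z t) = X u + t * m" and sz: "snd (z t) = Y u + t * m" for t
    using m by (auto simp: z_def m_def)
  have t0: "((\<lambda>t. c + t * m) \<longlongrightarrow> c) (at_right 0)" for c :: real
    by (rule tendsto_eq_intros refl | simp)+
  have "eventually (\<lambda>t. \<forall>w\<in>W. X w \<noteq> X u \<longrightarrow> (X w < X u + t * m \<longleftrightarrow> X w < X u)) (at_right 0)"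
    by (intro eventually_ball_finite finW ballI)
      (use tendsto_eventually_same_side(1)[OF t0] in simp)
  moreover have "eventually (\<lambda>t. \<forall>w\<in>W. Y w \<noteq> Y u \<longrightarrow> (Y u + t * m < Y w \<longleftrightarrow> Y u < Y w)) (at_right 0)"
    by (intro eventually_ball_finite finW ballI)
      (use tendsto_eventually_same_side(2)[OF t0] in simp)
  moreover have "eventually (\<lambda>t::real. 0 < t) (at_right 0)" by (simp add: eventually_at_right_less)
  moreover have "eventually (\<lambda>t::real. t < 1/2) (at_right 0)"
    by (rule order_tendstoD(2)[OF tendsto_ident_at]) simp
  ultimately have "eventually (\<lambda>t. 0 < t \<and> t < 1/2 \<and>
      (\<forall>w\<in>W. X w \<noteq> X u \<longrightarrow> (X w < X u + t * m \<longleftrightarrow> X w < X u)) \<and>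
      (\<forall>w\<in>W. Y w \<noteq> Y u \<longrightarrow> (Y u + t * m < Y w \<longleftrightarrow> Y u < Y w))) (at_right 0)"
    by eventually_elim auto
  from eventually_happens'[OF _ this] obtain t where t: "0 < t" "t < 1/2"
    and tX: "\<And>w. w \<in> W \<Longrightarrow> X w \<noteq> X u \<Longrightarrow> X w < X u + t * m \<longleftrightarrow> X w < X u"
    and tY: "\<And>w. w \<in> W \<Longrightarrow> Y w \<noteq> Y u \<Longrightarrow> Y u + t * m < Y w \<longleftrightarrow> Y u < Y w"
    by force
  have mid: "midpoint (p u) (p (d u)) = z (1/2)"
    by (simp add: z_def midpoint_def prod_eq_iff field_simps)
  have "off_edges W y" if "y \<in> closed_segment (z t) (z (1/2))" for y
  proof -
    obtain s where s: "0 \<le> s" "s \<le> 1" "y = (1 - s) *\<^sub>R z t + s *\<^sub>R z (1/2)"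
      using \<open>y \<in> _\<close> by (auto simp: in_segment)
    define r where "r = (1 - s) * t + s * (1/2)"
    have y: "y = z r"
      by (simp add: s z_def r_def algebra_simps scaleR_add_left[symmetric] del: scaleR_add_left)
    have "(1 - s) * t \<ge> 0" "(1 - s) * t \<le> (1 - s) * (1/2)" using s t mult_left_mono[of t "1/2" "1 - s"] by auto
    moreover have "r > 0" 
    proof (cases "s = 0")
      case False then show ?thesis using s t calculation by (auto simp: r_def intro!: add_nonneg_pos)
    qed (use t in \<open>simp add: r_def\<close>)
    ultimately have r: "0 < r" "r \<le> 1/2" by (auto simp: r_def algebra_simps)
    show ?thesis
    proof (rule off_edges_d[OF W uV])
      show "y \<in> closed_segment (p u) (p (d u))"
        using r by (auto simp: y z_def in_segment intro!: exI[of _ r] simp: algebra_simps)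
      have "r * m \<noteq> 0" "r * m \<noteq> m" using m r by auto
      moreover have "X (d u) = X u + m" by (simp add: m_def)
      ultimately have "fst y \<noteq> X (d u)" "fst y \<noteq> X u" by (simp_all add: y fz)
      then show "y \<noteq> p (d u)" "y \<noteq> p u \<or> u \<notin> W" by auto
    qed
  qed
  then have "side W u = odd_northwest W (z t)"
    using odd_northwest_constant[OF W, of "z t" "z (1/2)"] by (simp add: side_def mid)
  also have "\<dots> = odd (card {w \<in> W. X w < X u + t * m \<and> Y u + t * m < Y w})"
    by (simp add: odd_northwest_def fz sz)
  also have "{w \<in> W. X w < X u + t * m \<and> Y u + t * m < Y w} =
    (if 0 < m then {w \<in> W. X w \<le> X u \<and> Y u < Y w} else {w \<in> W. X w < X u \<and> Y u \<le> Y w})"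
  proof (cases "0 < m")
    case True
    then have "0 < t * m" using t by simp
    then have "X w < X u + t * m \<longleftrightarrow> X w \<le> X u" "Y u + t * m < Y w \<longleftrightarrow> Y u < Y w" if "w \<in> W" for w
      using tX[OF that] tY[OF that] by (cases "X w = X u"; cases "Y w = Y u"; auto)+
    then show ?thesis using True by auto
  next
    case False
    then have "t * m < 0" using t m by (simp add: mult_less_0_iff)
    then have "X w < X u + t * m \<longleftrightarrow> X w < X u" "Y u + t * m < Y w \<longleftrightarrow> Y u \<le> Y w" if "w \<in> W" for w
      using tX[OF that] tY[OF that] by (cases "X w = X u"; cases "Y w = Y u"; auto)+
    then show ?thesis using False by auto
  qed
  finally show ?thesis by (auto simp: m_def)
qed

lemma vertex_on_edge:
  assumes "u \<in> V" "w \<in> V" "f \<in> {h, b}" "p u \<in> closed_segment (p w) (p (f w))"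
  shows "u = w \<or> u = f w"
proof (rule ccontr)
  assume n: "\<not> (u = w \<or> u = f w)"
  then have "{u, d u} \<noteq> {w, f w}" by auto
  then have "p u \<in> p ` ({u, d u} \<inter> {w, f w})"
    using noncrossing[of u w d f "p u"] assms by auto
  then obtain y where "y = u \<or> y = d u" "y = w \<or> y = f w" "p u = p y" by auto
  then show False using n X_d[of u] assms by auto
qed

text \<open>
  The counting step behind the comparisons of parities below: all vertices of \<open>D\<close> come in pairs
  except the partner of \<open>u\<close>, whose own partner \<open>u\<close> is missing.
\<close>

lemma odd_card_partner:
  assumes W: "two_direction_closed W" and u: "u \<in> W" and D: "D \<subseteq> W" "f \<in> {h, b}"
    and step: "\<And>w. w \<in> D \<Longrightarrow> w \<noteq> f u \<Longrightarrow> f w \<in> D" and "u \<notin> D"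
  shows "odd (card D) \<longleftrightarrow> f u \<in> D"
proof -
  have uV: "u \<in> V" and fin: "finite D"
    using W u D finite_V by (auto simp: two_direction_closed_def intro: finite_subset)
  have "even (card (D - {f u}))"
  proof (rule even_card_involution[where f=f])
    fix w assume w: "w \<in> D - {f u}"
    have "w \<in> V" using w D W by (auto simp: two_direction_closed_def)
    then show "f w \<in> D - {f u} \<and> f (f w) = w \<and> f w \<noteq> w"
      using w D step \<open>u \<notin> D\<close> matching[of f w] matching[of f u] uV
      by (metis Diff_iff insert_iff singletonD)
  qed (use fin in simp)
  then show ?thesis using fin by (cases "f u \<in> D") (auto simp: card_Diff_singleton card_gt_0_iff)
qed

text \<open>
  Passing from \<open>u\<close> to a nearby point on its diagonal edge adds to the strict northwest quadrant
  either the vertices straight above \<open>u\<close> or those straight to its left. These come in pairs,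
  except possibly the neighbour of \<open>u\<close> itself.
\<close>

lemma side_corner:
  assumes W: "two_direction_closed W" and u: "u \<in> W"
  shows "side W u \<longleftrightarrow>
    odd_northwest W (p u) \<noteq> (if X u < X (d u) then Y u < Y (b u) else X (h u) < X u)"
proof -
  have finW: "finite W" using W finite_V finite_subset by (auto simp: two_direction_closed_def)
  have uV: "u \<in> V" and cl: "h u \<in> W" "b u \<in> W" using W u by (auto simp: two_direction_closed_def)
  show ?thesis
  proof (cases "X u < X (d u)")
    case True
    have "{w \<in> W. (X w \<le> X u \<and> Y u < Y w) \<noteq> (X w < X u \<and> Y u < Y w)} = {w \<in> W. X w = X u \<and> Y u < Y w}"
      (is "_ = ?D") by auto
    moreover have "odd (card ?D) \<longleftrightarrow> b u \<in> ?D"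
    proof (rule odd_card_partner[OF W u])
      fix w assume w: "w \<in> ?D" "w \<noteq> b u"
      have wV: "w \<in> V" and cl': "b w \<in> W" using W w by (auto simp: two_direction_closed_def)
      have "u \<noteq> w" "u \<noteq> b w" using w matching[of b w] wV by auto
      then have "p u \<notin> closed_segment (p w) (p (b w))" using vertex_on_edge uV wV by blast
      then show "b w \<in> ?D" using w cl' mem_vertical_edge[OF wV, of "p u"] vertical[OF wV] by auto
    qed auto
    ultimately show ?thesis
      using odd_card_Collect[OF finW, of "\<lambda>w. X w \<le> X u \<and> Y u < Y w" "\<lambda>w. X w < X u \<and> Y u < Y w"]
        side_near[OF W u] True cl vertical[OF uV] by (auto simp: odd_northwest_def)
  next
    case False
    have "{w \<in> W. (X w < X u \<and> Y u \<le> Y w) \<noteq> (X w < X u \<and> Y u < Y w)} = {w \<in> W. X w < X u \<and> Y w = Y u}"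
      (is "_ = ?D") by auto
    moreover have "odd (card ?D) \<longleftrightarrow> h u \<in> ?D"
    proof (rule odd_card_partner[OF W u])
      fix w assume w: "w \<in> ?D" "w \<noteq> h u"
      have wV: "w \<in> V" and cl': "h w \<in> W" using W w by (auto simp: two_direction_closed_def)
      have "u \<noteq> w" "u \<noteq> h w" using w matching[of h w] wV by auto
      then have "p u \<notin> closed_segment (p w) (p (h w))" using vertex_on_edge uV wV by blast
      then show "h w \<in> ?D" using w cl' mem_horizontal_edge[OF wV, of "p u"] horizontal[OF wV] by auto
    qed auto
    ultimately show ?thesis
      using odd_card_Collect[OF finW, of "\<lambda>w. X w < X u \<and> Y u \<le> Y w" "\<lambda>w. X w < X u \<and> Y u < Y w"]
        side_near[OF W u] False cl horizontal[OF uV] by (auto simp: odd_northwest_def)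
  qed
qed


text \<open>
  The quadrants of the two ends of a horizontal edge differ by the vertical strip above the edge
  (with its left boundary line). Vertical edges in the strip do not cross the horizontal edge, so
  they contribute both ends or none, apart from the vertical edge at the left end \<open>u\<close>.
\<close>

lemma odd_northwest_step:
  assumes W: "two_direction_closed W" and u: "u \<in> W" and less: "X u < X (h u)"
  shows "odd_northwest W (p u) \<noteq> odd_northwest W (p (h u)) \<longleftrightarrow> Y u < Y (b u)"
proof -
  have finW: "finite W" using W finite_V finite_subset by (auto simp: two_direction_closed_def)
  have uV: "u \<in> V" and cl: "h u \<in> W" "b u \<in> W" using W u by (auto simp: two_direction_closed_def)
  have yh: "Y (h u) = Y u" using horizontal uV by auto
  let ?D = "{w \<in> W. X u \<le> X w \<and> X w < X (h u) \<and> Y u < Y w}"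
  have "{w \<in> W. (X w < fst (p u) \<and> snd (p u) < Y w) \<noteq> (X w < fst (p (h u)) \<and> snd (p (h u)) < Y w)} = ?D"
    using yh less by auto
  moreover have "odd (card ?D) \<longleftrightarrow> b u \<in> ?D"
  proof (rule odd_card_partner[OF W u])
    fix w assume w: "w \<in> ?D" "w \<noteq> b u"
    have wV: "w \<in> V" and cl': "b w \<in> W" using W w by (auto simp: two_direction_closed_def)
    have xb: "X (b w) = X w" using vertical wV by auto
    have "\<not> Y (b w) \<le> Y u"
    proof
      assume le: "Y (b w) \<le> Y u"
      \<comment> \<open>the point where the two edges would cross\<close>
      let ?z = "(X w, Y u)"
      have "?z \<in> closed_segment (p w) (p (b w))" "?z \<in> closed_segment (p u) (p (h u))"
        using w le by (auto simp: mem_vertical_edge[OF wV] mem_horizontal_edge[OF uV])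
      moreover have ne: "w \<noteq> u" "w \<noteq> h u" using w yh by auto
      ultimately have "?z \<in> p ` ({w, b w} \<inter> {u, h u})"
        using noncrossing[of w u b h ?z] wV uV by (auto simp: doubleton_eq_iff)
      then have "?z = p (b w)" "b w = u \<or> b w = h u" using ne w by auto
      then have "b w = u" using w xb by auto
      then show False using w matching[of b w] wV by auto
    qed
    then show "b w \<in> ?D" using w cl' xb by auto
  qed auto
  moreover have "b u \<in> ?D \<longleftrightarrow> Y u < Y (b u)" using cl less vertical[OF uV] by auto
  ultimately show ?thesis
    using odd_card_Collect[OF finW, of "\<lambda>w. X w < fst (p u) \<and> snd (p u) < Y w" "\<lambda>w. X w < fst (p (h u)) \<and> snd (p (h u)) < Y w"]
    by (simp add: odd_northwest_def)
qed

text \<open>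
  Two consecutive corners of a polygon have their diagonal edges on the same side of it exactly if
  the cyclic orders of the three directions at them are opposite.
\<close>

lemma side_step_h:
  assumes W: "two_direction_closed W" and u: "u \<in> W"
  shows "side W u = side W (h u) \<longleftrightarrow> tripod u \<noteq> tripod (h u)"
proof -
  have *: "side W u = side W (h u) \<longleftrightarrow> tripod u \<noteq> tripod (h u)"
    if u: "u \<in> W" and less: "X u < X (h u)" for u
  proof -
    have uV: "u \<in> V" and hu: "h u \<in> W" using W u by (auto simp: two_direction_closed_def)
    have hh: "h (h u) = u" and hV: "h u \<in> V" using matching[of h u] uV by auto
    have "tripod u \<longleftrightarrow> Y u < Y (b u) \<and> \<not> X u < X (d u)"
      using less X_d[OF uV] by (auto simp: tripod_def)
    moreover have "tripod (h u) \<longleftrightarrow> \<not> Y (h u) < Y (b (h u)) \<and> X (h u) < X (d (h u))"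
      using less hh X_d[OF hV] by (auto simp: tripod_def)
    moreover have "side W u \<longleftrightarrow> odd_northwest W (p u) \<noteq> (X u < X (d u) \<and> Y u < Y (b u))"
      using side_corner[OF W u] less by auto
    moreover have "side W (h u) \<longleftrightarrow>
        odd_northwest W (p (h u)) \<noteq> (X (h u) < X (d (h u)) \<longrightarrow> Y (h u) < Y (b (h u)))"
      using side_corner[OF W hu] less hh by auto
    ultimately show ?thesis
      using odd_northwest_step[OF W u less] by argo
  qed
  have uV: "u \<in> V" and hu: "h u \<in> W" using W u by (auto simp: two_direction_closed_def)
  have hh: "h (h u) = u" using matching[of h u] uV by auto
  show ?thesis
  proof (cases "X u < X (h u)")
    case True
    then show ?thesis using *[OF u] by blast
  next
    case False
    then have "X (h u) < X (h (h u))" using X_h[OF uV] hh by auto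
    then show ?thesis using *[OF hu] hh by auto
  qed
qed

lemma side_step_b:
  assumes W: "two_direction_closed W" and u: "u \<in> W"
  shows "side W u = side W (b u) \<longleftrightarrow> tripod u \<noteq> tripod (b u)"
proof -
  interpret m: three_direction_drawing V "\<lambda>v. (- snd (p v), - fst (p v))" b h d A
    by (rule mirror)
  have side: "m.side W v = side W v" if "v \<in> V" for v
  proof -
    let ?M = "midpoint (p v) (p (d v))"
    have "midpoint (- snd (p v), - fst (p v)) (- snd (p (d v)), - fst (p (d v))) = (- snd ?M, - fst ?M)"
      by (simp add: midpoint_def add_divide_distrib)
    then show ?thesis
      by (simp add: m.side_def side_def m.odd_northwest_def odd_northwest_def conj_commute)
  qed
  have tri: "m.tripod v = tripod v" if "v \<in> V" for v
    using that X_h[of v] Y_b[of v] X_d[of v] diagonal[of v] by (auto simp: m.tripod_def tripod_def)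
  have "m.two_direction_closed W"
    using W by (auto simp: m.two_direction_closed_def two_direction_closed_def)
  moreover have "u \<in> V" "b u \<in> V" using W u by (auto simp: two_direction_closed_def)
  ultimately show ?thesis using m.side_step_h[of W u] u side tri by simp
qed

section \<open>Balance on bicoloured cycles\<close>

definition sgn_class :: "'a \<Rightarrow> int" where
  "sgn_class v = (if v \<in> A then 1 else - 1)"

definition sgn_tripod :: "'a \<Rightarrow> int" where
  "sgn_tripod v = (if tripod v then 1 else - 1)"

lemma sum_sgn_class_matched:
  assumes "S \<subseteq> V" "f \<in> {h, b, d}" "f ` S \<subseteq> S"
  shows "sum sgn_class S = 0"
proof (rule sum_involution_eq_0[where f=f])
  fix x assume "x \<in> S"
  then show "f x \<in> S \<and> f (f x) = x \<and> sgn_class (f x) = - sgn_class x"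
    using matching[of f x] assms by (auto simp: sgn_class_def)
qed

text \<open>
  The vertices with diagonal edges inside are balanced by the diagonal matching, those of them that
  are not on the polygon by the horizontal matching; the difference is the set in question. The
  second equation follows as \<open>W\<close> itself is balanced.
\<close>

lemma sum_sgn_class_side:
  assumes W: "two_direction_closed W"
  shows "sum sgn_class {v \<in> W. side W v} = 0" "sum sgn_class {v \<in> W. \<not> side W v} = 0"
proof -
  have WV: "W \<subseteq> V" and fW: "finite W" and hW: "h ` W \<subseteq> W"
    using W finite_V finite_subset by (auto simp: two_direction_closed_def)
  let ?T = "{v \<in> V. side W v}"
  have "sum sgn_class ?T = 0"
    by (rule sum_sgn_class_matched[where f=d]) (use matching side_d in auto)
  moreover have "sum sgn_class (?T - W) = 0"
  proof (rule sum_sgn_class_matched[where f=h])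
    show "h ` (?T - W) \<subseteq> ?T - W"
    proof safe
      fix v assume v: "v \<in> V" "side W v" "v \<notin> W"
      show "h v \<in> V" using matching v by auto
      show "side W (h v)" using side_step_outside[OF W v(1,3), of h] v by auto
      assume "h v \<in> W"
      then have "h (h v) \<in> W" using hW by auto
      then show False using matching[of h v] v by auto
    qed
  qed auto
  moreover have "sum sgn_class ?T = sum sgn_class (?T - W) + sum sgn_class {v \<in> W. side W v}"
    using finite_V WV by (subst sum.union_disjoint[symmetric]) (auto intro!: sum.cong finite_subset[OF WV])
  ultimately show *: "sum sgn_class {v \<in> W. side W v} = 0" by simp
  have "sum sgn_class W = 0"
    by (rule sum_sgn_class_matched[where f=h]) (use WV hW in auto)
  moreover have "sum sgn_class W = sum sgn_class {v \<in> W. side W v} + sum sgn_class {v \<in> W. \<not> side W v}"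
    using fW by (subst sum.union_disjoint[symmetric]) (auto intro!: sum.cong)
  ultimately show "sum sgn_class {v \<in> W. \<not> side W v} = 0" using * by simp
qed

text \<open>
  Along an edge of the polygon the colour class always changes, and by \<open>side_step_h\<close> and
  \<open>side_step_b\<close> exactly one of side and tripod status changes. So the product of side, class and
  tripod status is constant on the polygon, and on each side the tripod signs are the class
  signs up to a common factor.
\<close>

lemma sum_sgn_tripod_minimal:
  assumes W: "two_direction_closed W"
    and minimal: "\<And>K. two_direction_closed K \<Longrightarrow> K \<subseteq> W \<Longrightarrow> K = {} \<or> K = W"
  shows "sum sgn_tripod W = 0"
proof -
  have WV: "W \<subseteq> V" and fW: "finite W" and cl: "h ` W \<subseteq> W" "b ` W \<subseteq> W"
    using W finite_V finite_subset by (auto simp: two_direction_closed_def)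
  \<comment> \<open>Minimality of \<open>W\<close> takes the place of walking around the polygon: where the product of side,
    class and tripod status has a given value is a closed set.\<close>
  define K where "K = {v \<in> W. side W v \<longleftrightarrow> (tripod v \<longleftrightarrow> v \<in> A)}"
  have "f v \<in> K" if v: "v \<in> K" and f: "f \<in> {h, b}" for f v
  proof -
    have vW: "v \<in> W" and fvW: "f v \<in> W" using v f cl by (auto simp: K_def)
    have "side W v = side W (f v) \<longleftrightarrow> tripod v \<noteq> tripod (f v)"
      using side_step_h[OF W vW] side_step_b[OF W vW] f by auto
    moreover have "f v \<in> A \<longleftrightarrow> v \<notin> A" using matching[of f v] f vW WV by auto
    moreover have "side W v \<longleftrightarrow> (tripod v \<longleftrightarrow> v \<in> A)" using v by (simp add: K_def)
    ultimately have "side W (f v) \<longleftrightarrow> (tripod (f v) \<longleftrightarrow> f v \<in> A)" by argo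
    then show ?thesis using fvW by (simp add: K_def)
  qed
  then have "two_direction_closed K"
    using WV by (auto simp: two_direction_closed_def K_def)
  then consider "K = W" | "K = {}" using minimal[of K] by (auto simp: K_def)
  then obtain c :: int where c: "\<And>v. v \<in> W \<Longrightarrow> sgn_tripod v = (if side W v then c else - c) * sgn_class v"
  proof cases
    case 1
    show ?thesis
      by (rule that[of 1]) (use 1 in \<open>auto simp: K_def sgn_tripod_def sgn_class_def\<close>)
  next
    case 2
    show ?thesis
      by (rule that[of "-1"]) (use 2 in \<open>auto simp: K_def sgn_tripod_def sgn_class_def\<close>)
  qed
  have "sum sgn_tripod W = sum sgn_tripod {v \<in> W. side W v} + sum sgn_tripod {v \<in> W. \<not> side W v}"
    using fW by (subst sum.union_disjoint[symmetric]) (auto intro!: sum.cong)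
  also have "sum sgn_tripod {v \<in> W. side W v} = c * sum sgn_class {v \<in> W. side W v}"
    by (simp add: sum_distrib_left c)
  also have "sum sgn_tripod {v \<in> W. \<not> side W v} = - c * sum sgn_class {v \<in> W. \<not> side W v}"
    unfolding sum_distrib_left by (rule sum.cong) (auto simp: c)
  finally show ?thesis using sum_sgn_class_side[OF W] by simp
qed

lemma two_direction_closed_Diff:
  assumes "two_direction_closed W" "two_direction_closed K"
  shows "two_direction_closed (W - K)"
proof -
  have "f v \<in> W - K" if "v \<in> W - K" "f \<in> {h, b}" for f v
  proof -
    have "f v \<in> W" using assms(1) that by (auto simp: two_direction_closed_def)
    moreover have "f v \<notin> K"
    proof
      assume "f v \<in> K"
      then have "f (f v) \<in> K" using assms(2) that by (auto simp: two_direction_closed_def)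
      then show False using matching[of f v] that assms(1) by (auto simp: two_direction_closed_def)
    qed
    ultimately show ?thesis by blast
  qed
  then show ?thesis using assms by (auto simp: two_direction_closed_def)
qed

lemma sum_sgn_tripod_closed:
  assumes "two_direction_closed W"
  shows "sum sgn_tripod W = 0"
proof -
  have "finite W" using assms finite_V finite_subset by (auto simp: two_direction_closed_def)
  then show ?thesis using assms
  proof (induction W rule: finite_psubset_induct)
    case (psubset W)
    show ?case
    proof (cases "\<forall>K. two_direction_closed K \<longrightarrow> K \<subseteq> W \<longrightarrow> K = {} \<or> K = W")
      case True
      then show ?thesis using sum_sgn_tripod_minimal psubset.prems by blast
    next
      case False
      then obtain K where K: "two_direction_closed K" "K \<subset> W" "K \<noteq> {}" by blast
      then have "sum sgn_tripod K = 0" "sum sgn_tripod (W - K) = 0"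
        using psubset.IH two_direction_closed_Diff psubset.prems by blast+
      then show ?thesis using sum.subset_diff[of K W sgn_tripod] K psubset.hyps by auto
    qed
  qed
qed

theorem card_tripods: "card {v \<in> V. \<not> tripod v} = card {v \<in> V. tripod v}"
proof -
  have "two_direction_closed V" using matching by (auto simp: two_direction_closed_def)
  then have "0 = sum sgn_tripod V" using sum_sgn_tripod_closed by simp
  also have "\<dots> = sum sgn_tripod {v \<in> V. tripod v} + sum sgn_tripod {v \<in> V. \<not> tripod v}"
    using finite_V by (subst sum.union_disjoint[symmetric]) (auto intro!: sum.cong)
  also have "\<dots> = int (card {v \<in> V. tripod v}) - int (card {v \<in> V. \<not> tripod v})"
    by (simp add: sgn_tripod_def)
  finally show ?thesis by simp
qed

end

section \<open>From lines to coordinates\<close>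

lemma affine_parallel_lines_imp:
  fixes u v x y :: "'a::real_vector"
  assumes "affine_parallel (affine hull {u, v}) (affine hull {x, y})"
  shows "\<exists>t. v - u = t *\<^sub>R (y - x)"
proof -
  obtain k where k: "affine hull {x, y} = (\<lambda>z. k + z) ` (affine hull {u, v})"
    using assms by (auto simp: affine_parallel_def)
  have "u \<in> affine hull {u, v}" "v \<in> affine hull {u, v}" by (auto intro: hull_inc)
  then have "k + u \<in> affine hull {x, y}" "k + v \<in> affine hull {x, y}" using k by auto
  then obtain s r where "k + u = x + s *\<^sub>R (y - x)" "k + v = x + r *\<^sub>R (y - x)"
    by (auto simp: affine_hull_2_alt)
  then have "(k + v) - (k + u) = (x + r *\<^sub>R (y - x)) - (x + s *\<^sub>R (y - x))"
    by (simp only:)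
  also have "\<dots> = (r - s) *\<^sub>R (y - x)"
    by (simp add: scaleR_left_diff_distrib)
  finally show ?thesis by auto
qed

lemma affine_parallel_linesI:
  fixes u v x y :: "'a::real_vector"
  assumes "v - u = t *\<^sub>R (y - x)" "u \<noteq> v"
  shows "affine_parallel (affine hull {u, v}) (affine hull {x, y})"
proof -
  have t: "t \<noteq> 0" using assms by auto
  have "(\<lambda>z. (x - u) + z) ` range (\<lambda>s. u + s *\<^sub>R (v - u)) = range (\<lambda>s. x + s *\<^sub>R (y - x))"
  proof (intro equalityI subsetI)
    fix z assume "z \<in> (\<lambda>z. (x - u) + z) ` range (\<lambda>s. u + s *\<^sub>R (v - u))"
    then obtain s where "z = (x - u) + (u + s *\<^sub>R (v - u))" by blast
    then have "z = x + (s * t) *\<^sub>R (y - x)" using assms(1) by simp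
    then show "z \<in> range (\<lambda>s. x + s *\<^sub>R (y - x))" by blast
  next
    fix z assume "z \<in> range (\<lambda>s. x + s *\<^sub>R (y - x))"
    then obtain s where "z = x + s *\<^sub>R (y - x)" by auto
    then have "z = (x - u) + (u + (s / t) *\<^sub>R (v - u))" using assms(1) t by auto
    then show "z \<in> (\<lambda>z. (x - u) + z) ` range (\<lambda>s. u + s *\<^sub>R (v - u))" by blast
  qed
  then show ?thesis
    unfolding affine_parallel_def affine_hull_2_alt by metis
qed

definition cross2 :: "real^2 \<Rightarrow> real^2 \<Rightarrow> real" where
  "cross2 x y = x$1 * y$2 - x$2 * y$1"

lemma cross2_eq_0:
  assumes "cross2 x y = 0" "y \<noteq> 0"
  shows "\<exists>t. x = t *\<^sub>R y"
proof (cases "y$1 = 0")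
  case True
  then have "y$2 \<noteq> 0" using assms(2) by (auto simp: vec_eq_iff forall_2)
  then show ?thesis
    using assms(1) True by (intro exI[of _ "x$2 / y$2"]) (auto simp: vec_eq_iff forall_2 cross2_def)
next
  case False
  then show ?thesis
    using assms(1) by (intro exI[of _ "x$1 / y$1"]) (auto simp: vec_eq_iff forall_2 cross2_def field_simps)
qed

text \<open>
  Each coordinate is the signed area against the direction in which it vanishes, scaled so that
  \<open>d3\<close> becomes \<open>(1, 1)\<close>.
\<close>

lemma exists_three_direction_coordinates:
  assumes "cross2 d1 d2 \<noteq> 0" "cross2 d3 d2 \<noteq> 0" "cross2 d3 d1 \<noteq> 0"
  obtains m1 m2 :: "real^2" where "m1 \<bullet> d2 = 0" "m2 \<bullet> d1 = 0" "m1 \<bullet> d3 = 1" "m2 \<bullet> d3 = 1"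
    "\<And>z. m1 \<bullet> z = 0 \<Longrightarrow> m2 \<bullet> z = 0 \<Longrightarrow> z = 0"
proof -
  define m where "m y = (1 / cross2 d3 y) *\<^sub>R (vector [y$2, - (y$1)] :: real^2)" for y
  have m: "m y \<bullet> z = cross2 z y / cross2 d3 y" for y z
    by (simp add: m_def inner_vec_def sum_2 cross2_def diff_divide_distrib mult.commute)
  have "z = 0" if "cross2 z d2 = 0" "cross2 z d1 = 0" for z
  proof -
    have "z$1 * cross2 d1 d2 = d1$1 * cross2 z d2 - d2$1 * cross2 z d1"
      "z$2 * cross2 d1 d2 = d1$2 * cross2 z d2 - d2$2 * cross2 z d1"
      by (simp_all add: cross2_def algebra_simps)
    then show ?thesis using that assms(1) by (simp add: vec_eq_iff forall_2)
  qed
  moreover have "cross2 y y = 0" for y by (simp add: cross2_def)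
  ultimately show ?thesis
    using assms by (intro that[of "m d2" "m d1"]) (auto simp: m)
qed

lemma perfect_matching_of_unique_edges:
  assumes G: "finite_graph V E"
    and unique: "\<And>v. v \<in> V \<Longrightarrow> \<exists>!e. e \<in> incident_edges E v \<and> Q e"
  obtains f where "\<And>v. v \<in> V \<Longrightarrow> f v \<in> V \<and> f (f v) = v \<and> f v \<noteq> v \<and> {v, f v} \<in> E \<and> Q {v, f v}"
proof -
  have ex: "\<exists>u. u \<in> V \<and> u \<noteq> v \<and> {v, u} \<in> E \<and> Q {v, u}" if v: "v \<in> V" for v
  proof -
    obtain e where e: "e \<in> E" "v \<in> e" "Q e" using unique[OF v] by (auto simp: incident_edges_def)
    then have "e \<subseteq> V" "card e = 2" using G by (auto simp: finite_graph_def)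
    then obtain x y where "e = {x, y}" "x \<noteq> y" by (auto simp: card_2_iff)
    then show ?thesis using e \<open>e \<subseteq> V\<close> by (auto simp: insert_commute)
  qed
  then obtain f where f: "\<And>v. v \<in> V \<Longrightarrow> f v \<in> V \<and> f v \<noteq> v \<and> {v, f v} \<in> E \<and> Q {v, f v}"
    by metis
  have "f (f v) = v" if v: "v \<in> V" for v
  proof -
    have fv: "f v \<in> V" using f v by blast
    have "{v, f v} \<in> incident_edges E (f v)" "{f v, f (f v)} \<in> incident_edges E (f v)"
      using f[OF v] f[OF fv] by (auto simp: incident_edges_def)
    then have "{v, f v} = {f v, f (f v)}" using unique[OF fv] f[OF v] f[OF fv] by blast
    then show ?thesis using f[OF v] by (auto simp: doubleton_eq_iff)
  qed
  then show ?thesis using f that by blast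
qed

lemma closed_segment_minus_subset_half_plane:
  assumes "x \<noteq> y"
  shows "closed_segment x y - {x} \<subseteq> {z. n \<bullet> z > n \<bullet> x} \<longleftrightarrow> n \<bullet> (y - x) > 0"
proof
  assume "closed_segment x y - {x} \<subseteq> {z. n \<bullet> z > n \<bullet> x}"
  then show "n \<bullet> (y - x) > 0" using assms by (auto simp: inner_diff_right)
next
  assume n: "n \<bullet> (y - x) > 0"
  show "closed_segment x y - {x} \<subseteq> {z. n \<bullet> z > n \<bullet> x}"
  proof
    fix z assume z: "z \<in> closed_segment x y - {x}"
    then obtain s where s: "0 \<le> s" "z = (1 - s) *\<^sub>R x + s *\<^sub>R y" by (auto simp: in_segment)
    then have "s \<noteq> 0" using z by auto
    then have "0 < s * (n \<bullet> (y - x))" using s n by simp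
    also have "s * (n \<bullet> (y - x)) = n \<bullet> z - n \<bullet> x"
      by (simp add: s algebra_simps inner_add_right inner_diff_right)
    finally show "z \<in> {z. n \<bullet> z > n \<bullet> x}" by simp
  qed
qed

text \<open>
  If the three vectors positively span the plane, a positive combination of them vanishes and no
  half-plane contains them. Otherwise a normal vector is found among the combinations of the two
  coordinate functionals.
\<close>

lemma half_plane_iff_signs:
  fixes m1 m2 w1 w2 w3 :: "'a::real_inner"
  assumes inj: "\<And>z. m1 \<bullet> z = 0 \<Longrightarrow> m2 \<bullet> z = 0 \<Longrightarrow> z = 0"
    and w: "m2 \<bullet> w1 = 0" "m1 \<bullet> w2 = 0" "m1 \<bullet> w3 = m2 \<bullet> w3"
    and nz: "m1 \<bullet> w1 \<noteq> 0" "m2 \<bullet> w2 \<noteq> 0" "m1 \<bullet> w3 \<noteq> 0"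
  shows "(\<exists>n. n \<bullet> w1 > 0 \<and> n \<bullet> w2 > 0 \<and> n \<bullet> w3 > 0) \<longleftrightarrow>
    \<not> ((m1 \<bullet> w1 > 0 \<longleftrightarrow> m2 \<bullet> w2 > 0) \<and> (m1 \<bullet> w1 > 0 \<longleftrightarrow> m1 \<bullet> w3 < 0))" (is "?L \<longleftrightarrow> \<not> ?R")
proof
  assume ?L
  then obtain n where n: "n \<bullet> w1 > 0" "n \<bullet> w2 > 0" "n \<bullet> w3 > 0" by blast
  show "\<not> ?R"
  proof
    assume R: ?R
    define r1 r2 where "r1 = - (m1 \<bullet> w3) / (m1 \<bullet> w1)" and "r2 = - (m1 \<bullet> w3) / (m2 \<bullet> w2)"
    have r: "r1 > 0" "r2 > 0"
      using R nz by (auto simp: r1_def r2_def zero_less_divide_iff divide_less_0_iff)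
    have "r1 *\<^sub>R w1 + r2 *\<^sub>R w2 + w3 = 0"
      by (rule inj) (use nz w in \<open>simp_all add: inner_add_right inner_diff_right r1_def r2_def\<close>)
    then have "n \<bullet> (r1 *\<^sub>R w1 + r2 *\<^sub>R w2 + w3) = 0" by simp
    then have "r1 * (n \<bullet> w1) + r2 * (n \<bullet> w2) + n \<bullet> w3 = 0" by (simp add: inner_add_right)
    moreover have "r1 * (n \<bullet> w1) > 0" "r2 * (n \<bullet> w2) > 0" using r n by auto
    ultimately show False using n by linarith
  qed
next
  assume R: "\<not> ?R"
  \<comment> \<open>The signs of the coefficients are forced by \<open>w1\<close> and \<open>w2\<close>. If they are opposite, the
    larger coefficient goes to the functional that decides the sign at \<open>w3\<close>.\<close>
  define c1 c2 :: real where "c1 = (if m1 \<bullet> w1 > 0 \<longleftrightarrow> m1 \<bullet> w3 > 0 then 2 else 1) * sgn (m1 \<bullet> w1)"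
    and "c2 = (if m1 \<bullet> w1 > 0 \<longleftrightarrow> m1 \<bullet> w3 > 0 then 1 else 2) * sgn (m2 \<bullet> w2)"
  have "c1 * (m1 \<bullet> w1) > 0" "c2 * (m2 \<bullet> w2) > 0" "(c1 + c2) * (m1 \<bullet> w3) > 0"
    using R nz by (auto simp: c1_def c2_def sgn_if not_less zero_less_mult_iff mult_less_0_iff)
  then show ?L
    using w by (intro exI[of _ "c1 *\<^sub>R m1 + c2 *\<^sub>R m2"]) (simp add: inner_add_left algebra_simps)
qed

theorem theorem2:
  fixes V :: "'a set" and E :: "'a set set" and pos :: "'a \<Rightarrow> real^2"
    and l1 l2 l3 :: "(real^2) set"
  assumes "finite_graph V E" and "cubic V E" and "bipartite V E"
    and "straight_plane_drawing V E pos"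
    and "is_line l1" and "is_line l2" and "is_line l3"
    and "\<not> affine_parallel l1 l2" and "\<not> affine_parallel l1 l3" and "\<not> affine_parallel l2 l3"
    and "\<And>v l. v \<in> V \<Longrightarrow> l \<in> {l1, l2, l3} \<Longrightarrow>
           \<exists>!e. e \<in> incident_edges E v \<and> edge_parallel pos e l"
  shows "card {v \<in> V. is_claw E pos v} = card {v \<in> V. is_tripod E pos v}"
proof (cases "V = {}")
  case False
  then obtain v0 where v0: "v0 \<in> V" by blast
  note G = assms(1) and drawing = assms(4)
  have ex: "\<exists>f. \<forall>v\<in>V. f v \<in> V \<and> f (f v) = v \<and> f v \<noteq> v \<and> {v, f v} \<in> E \<and> edge_parallel pos {v, f v} l"
    if "l \<in> {l1, l2, l3}" for l
    by (rule perfect_matching_of_unique_edges[OF G, of "\<lambda>e. edge_parallel pos e l"])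
      (erule assms(11)[OF _ that], blast)
  obtain h where h: "\<And>v. v \<in> V \<Longrightarrow> h v \<in> V \<and> h (h v) = v \<and> h v \<noteq> v \<and> {v, h v} \<in> E \<and> edge_parallel pos {v, h v} l1"
    using ex[of l1] by blast
  obtain b where b: "\<And>v. v \<in> V \<Longrightarrow> b v \<in> V \<and> b (b v) = v \<and> b v \<noteq> v \<and> {v, b v} \<in> E \<and> edge_parallel pos {v, b v} l2"
    using ex[of l2] by blast
  obtain d where d: "\<And>v. v \<in> V \<Longrightarrow> d v \<in> V \<and> d (d v) = v \<and> d v \<noteq> v \<and> {v, d v} \<in> E \<and> edge_parallel pos {v, d v} l3"
    using ex[of l3] by blast
  have partner: "f v \<in> V \<and> f (f v) = v \<and> f v \<noteq> v \<and> {v, f v} \<in> E"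
    if "f \<in> {h, b, d}" "v \<in> V" for f v
    using that h b d by auto
  have inj: "inj_on pos V" using drawing by (simp add: straight_plane_drawing_def)
  have pos_ne: "pos v \<noteq> pos (f v)" if "f \<in> {h, b, d}" "v \<in> V" for f v
    using partner[OF that] inj that by (auto simp: inj_on_def)

  have direction: "\<exists>t. pos (f v) - pos v = t *\<^sub>R (pos (f v0) - pos v0)"
    if "v \<in> V" "edge_parallel pos {v, f v} l" "edge_parallel pos {v0, f v0} l" for f v l
  proof -
    have "affine_parallel (affine hull {pos v, pos (f v)}) l"
      "affine_parallel (affine hull {pos v0, pos (f v0)}) l"
      using that(2,3) by (simp_all add: edge_parallel_def)
    then show ?thesis
      by (intro affine_parallel_lines_imp) (rule affine_parallel_assoc[OF _ affine_parallel_commute])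
  qed
  have independent: "cross2 (pos (f v0) - pos v0) (pos (g v0) - pos v0) \<noteq> 0"
    if fg: "f \<in> {h, b, d}" "g \<in> {h, b, d}" and par: "edge_parallel pos {v0, f v0} l" "edge_parallel pos {v0, g v0} l'"
      and "\<not> affine_parallel l l'" for f g l l'
  proof
    assume "cross2 (pos (f v0) - pos v0) (pos (g v0) - pos v0) = 0"
    then obtain t where "pos (f v0) - pos v0 = t *\<^sub>R (pos (g v0) - pos v0)"
      using cross2_eq_0[of _ "pos (g v0) - pos v0"] pos_ne[OF fg(2) v0] by auto
    then have "affine_parallel (affine hull {pos v0, pos (f v0)}) (affine hull {pos v0, pos (g v0)})"
      using affine_parallel_linesI pos_ne[OF fg(1) v0] by blast
    moreover have "affine_parallel l (affine hull {pos v0, pos (f v0)})"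
      "affine_parallel (affine hull {pos v0, pos (g v0)}) l'"
      using par affine_parallel_commute by (simp_all add: edge_parallel_def)
    ultimately show False
      using \<open>\<not> affine_parallel l l'\<close> by (blast intro: affine_parallel_assoc)
  qed
  have "cross2 (pos (h v0) - pos v0) (pos (b v0) - pos v0) \<noteq> 0"
    "cross2 (pos (d v0) - pos v0) (pos (b v0) - pos v0) \<noteq> 0"
    "cross2 (pos (d v0) - pos v0) (pos (h v0) - pos v0) \<noteq> 0"
    using independent[of h b l1 l2] independent[of d b l3 l2] independent[of d h l3 l1]
      h[OF v0] b[OF v0] d[OF v0] assms(8-10) affine_parallel_commute[of l3]
    by blast+
  then obtain m1 m2 where m: "m1 \<bullet> (pos (b v0) - pos v0) = 0" "m2 \<bullet> (pos (h v0) - pos v0) = 0"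
      "m1 \<bullet> (pos (d v0) - pos v0) = 1" "m2 \<bullet> (pos (d v0) - pos v0) = 1"
    and m_inj: "\<And>z. m1 \<bullet> z = 0 \<Longrightarrow> m2 \<bullet> z = 0 \<Longrightarrow> z = 0"
    by (rule exists_three_direction_coordinates) blast
  \<comment> \<open>In the coordinates \<open>L\<close>, \<open>l1\<close> is horizontal, \<open>l2\<close> vertical and \<open>l3\<close> diagonal.\<close>
  define L where "L z = (m1 \<bullet> z, m2 \<bullet> z)" for z
  have L_lin: "linear L"
    by (rule linearI) (auto simp: L_def inner_add_right)
  have L_inj: "inj L"
    using m_inj by (auto simp: linear_injective_0[OF L_lin] L_def zero_prod_def)
  have hm: "m2 \<bullet> (pos (h v) - pos v) = 0" if "v \<in> V" for v
    using direction[OF that, of h l1] h that v0 m by fastforce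
  have bm: "m1 \<bullet> (pos (b v) - pos v) = 0" if "v \<in> V" for v
    using direction[OF that, of b l2] b that v0 m by fastforce
  have dm: "m1 \<bullet> (pos (d v) - pos v) = m2 \<bullet> (pos (d v) - pos v)" if "v \<in> V" for v
    using direction[OF that, of d l3] d that v0 m by fastforce

  obtain A B where AB: "A \<union> B = V" "A \<inter> B = {}" "\<And>e. e \<in> E \<Longrightarrow> \<exists>x\<in>A. \<exists>y\<in>B. e = {x, y}"
    using assms(3) by (auto simp: bipartite_def)
  have edge_segment: "edge_segment pos {u, v} = closed_segment (pos u) (pos v)" for u v
    by (simp add: edge_segment_def segment_convex_hull)

  have planar: "edge_segment pos e \<inter> edge_segment pos e' \<subseteq> pos ` (e \<inter> e')"
    if "e \<in> E" "e' \<in> E" "e \<noteq> e'" for e e'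
    using drawing that by (simp add: straight_plane_drawing_def)

  interpret three_direction_drawing V "\<lambda>v. L (pos v)" h b d A
  proof
    show "finite V" using G by (simp add: finite_graph_def)
    show "inj_on (\<lambda>v. L (pos v)) V"
      using inj L_inj by (auto simp: inj_on_def)
    show "f v \<in> V \<and> f (f v) = v \<and> f v \<noteq> v \<and> (f v \<in> A \<longleftrightarrow> v \<notin> A)"
      if fv: "f \<in> {h, b, d}" "v \<in> V" for f v
    proof -
      obtain x y where "x \<in> A" "y \<in> B" "{v, f v} = {x, y}" using AB(3) partner[OF fv] by blast
      then show ?thesis using partner[OF fv] AB(2) by (auto simp: doubleton_eq_iff)
    qed
    show "z \<in> (\<lambda>v. L (pos v)) ` ({u, f u} \<inter> {v, g v})"
      if "u \<in> V" "v \<in> V" "f \<in> {h, b, d}" "g \<in> {h, b, d}" "{u, f u} \<noteq> {v, g v}"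
        "z \<in> closed_segment (L (pos u)) (L (pos (f u)))"
        "z \<in> closed_segment (L (pos v)) (L (pos (g v)))" for u v f g z
    proof -
      have "z \<in> L ` closed_segment (pos u) (pos (f u))" "z \<in> L ` closed_segment (pos v) (pos (g v))"
        using that closed_segment_linear_image[OF L_lin] by auto
      then obtain y where y: "z = L y" "y \<in> edge_segment pos {u, f u}" "y \<in> edge_segment pos {v, g v}"
        using L_inj by (auto simp: inj_on_def edge_segment)
      moreover have "{u, f u} \<in> E" "{v, g v} \<in> E" using that partner by auto
      ultimately have "y \<in> pos ` ({u, f u} \<inter> {v, g v})"
        using planar[OF _ _ that(5)] by (meson IntI subsetD)
      then show ?thesis using y by auto
    qed
  qed (use hm bm dm in \<open>auto simp: L_def inner_diff_right\<close>)

  have claw: "is_claw E pos v \<longleftrightarrow> \<not> tripod v" if v: "v \<in> V" for v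
  proof -
    have inc: "incident_edges E v = {{v, h v}, {v, b v}, {v, d v}}"
    proof -
      have three: "card (incident_edges E v) = 3" using assms(2) v by (simp add: cubic_def)
      then have "finite (incident_edges E v)" by (simp add: card_ge_0_finite)
      moreover have "{{v, h v}, {v, b v}, {v, d v}} \<subseteq> incident_edges E v"
        using partner[OF _ v] by (auto simp: incident_edges_def)
      moreover have "card {{v, h v}, {v, b v}, {v, d v}} = 3"
      proof -
        have "{v, h v} \<noteq> {v, b v}" "{v, h v} \<noteq> {v, d v}" "{v, b v} \<noteq> {v, d v}"
          using distinct_edges[OF v] by (auto simp: doubleton_eq_iff)
        then show ?thesis by simp
      qed
      ultimately show ?thesis using three card_subset_eq by metis
    qed
    have "is_claw E pos v \<longleftrightarrow> (\<exists>n. n \<noteq> 0 \<and> n \<bullet> (pos (h v) - pos v) > 0 \<and>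
        n \<bullet> (pos (b v) - pos v) > 0 \<and> n \<bullet> (pos (d v) - pos v) > 0)"
      using pos_ne[OF _ v]
      by (simp add: is_claw_def inc edge_segment closed_segment_minus_subset_half_plane)
    also have "\<dots> \<longleftrightarrow> (\<exists>n. n \<bullet> (pos (h v) - pos v) > 0 \<and>
        n \<bullet> (pos (b v) - pos v) > 0 \<and> n \<bullet> (pos (d v) - pos v) > 0)"
      by (metis inner_zero_left less_irrefl)
    also have "\<dots> \<longleftrightarrow> \<not> tripod v"
      using X_h[OF v] Y_b[OF v] X_d[OF v] unfolding tripod_def
      by (subst half_plane_iff_signs[of m1 m2, OF m_inj hm[OF v] bm[OF v] dm[OF v]])
        (auto simp: L_def inner_diff_right)
    finally show ?thesis .
  qed
  have "{v \<in> V. is_claw E pos v} = {v \<in> V. \<not> tripod v}"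
    "{v \<in> V. is_tripod E pos v} = {v \<in> V. tripod v}"
    using claw by (auto simp: is_tripod_def)
  then show ?thesis using card_tripods by simp
qed simp

end
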